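(* Let $\Gamma$ be a finitely generated group which is an FC-central extension of a group $G$. If $G$ is of sub-exponential growth, then $\Gamma$ is of sub-exponential growth as well.
   Context: The FC-center $Z_{\mathrm{FC}}(\Gamma)$ of a group $\Gamma$ is the set of all elements with finite conjugacy class. $\Gamma$ is an FC-central extension of $G$ if there is a surjective homomorphism $\Gamma\to G$ whose kernel is contained in $Z_{\mathrm{FC}}(\Gamma)$. For a group $G$ with finite generating set $S$, $v_{G,S}(n)$ is the number of elements of word length at most $n$; $G$ is of sub-exponential growth if $\lim_{n\to\infty}v_{G,S}(n)^{1/n}=1$ (this does not depend on the finite generating set $S$). *)

theory Defs
  imports Complex_Main "HOL-Algebra.Generated_Groups"
begin

definition FC_center :: "('a, 'b) monoid_scheme \<Rightarrow> 'a set"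
  where "FC_center G =
    {x \<in> carrier G. finite {g \<otimes>\<^bsub>G\<^esub> x \<otimes>\<^bsub>G\<^esub> inv\<^bsub>G\<^esub> g | g. g \<in> carrier G}}"

definition FC_central_extension :: "('a, 'c) monoid_scheme \<Rightarrow> ('b, 'd) monoid_scheme \<Rightarrow> bool"
  where "FC_central_extension \<Gamma> G \<longleftrightarrow> (\<exists>f \<in> epi \<Gamma> G. kernel \<Gamma> G f \<subseteq> FC_center \<Gamma>)"

definition finite_generating_set :: "('a, 'b) monoid_scheme \<Rightarrow> 'a set \<Rightarrow> bool"
  where "finite_generating_set G S \<longleftrightarrow> finite S \<and> S \<subseteq> carrier G \<and> generate G S = carrier G"

definition finitely_generated :: "('a, 'b) monoid_scheme \<Rightarrow> bool"
  where "finitely_generated G \<longleftrightarrow> (\<exists>S. finite_generating_set G S)"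

definition words :: "('a, 'b) monoid_scheme \<Rightarrow> 'a set \<Rightarrow> 'a list set"
  where "words G S = lists (S \<union> m_inv G ` S)"

definition word_prod :: "('a, 'b) monoid_scheme \<Rightarrow> 'a list \<Rightarrow> 'a"
  where "word_prod G ws = foldr (\<otimes>\<^bsub>G\<^esub>) ws \<one>\<^bsub>G\<^esub>"

text \<open>The word length is only meaningful for elements of the subgroup generated by \<open>S\<close>;
  for other elements the set of lengths is empty and the value is unspecified.\<close>

definition word_length :: "('a, 'b) monoid_scheme \<Rightarrow> 'a set \<Rightarrow> 'a \<Rightarrow> nat"
  where "word_length G S x = (LEAST n. \<exists>ws \<in> words G S. length ws = n \<and> word_prod G ws = x)"

definition growth :: "('a, 'b) monoid_scheme \<Rightarrow> 'a set \<Rightarrow> nat \<Rightarrow> nat"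
  where "growth G S n = card {x \<in> carrier G. word_length G S x \<le> n}"

text \<open>The quantifier over \<open>S\<close> may equivalently be universal (for finitely generated groups):
  see \<open>sub_exponential_growth_iff\<close> below.\<close>

definition sub_exponential_growth :: "('a, 'b) monoid_scheme \<Rightarrow> bool"
  where "sub_exponential_growth G \<longleftrightarrow>
    (\<exists>S. finite_generating_set G S \<and> (\<lambda>n. root n (real (growth G S n))) \<longlonglongrightarrow> 1)"

context group
begin

lemma words_closed:
  assumes "S \<subseteq> carrier G" "ws \<in> words G S"
  shows "word_prod G ws \<in> carrier G"
proof -
  have "set ws \<subseteq> carrier G"
    using assms by (auto simp: words_def)
  then show ?thesis
    by (induction ws) (auto simp: word_prod_def)
qed

lemma word_prod_append:
  assumes "S \<subseteq> carrier G" "us \<in> words G S" "ws \<in> words G S"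
  shows "word_prod G (us @ ws) = word_prod G us \<otimes> word_prod G ws"
  using assms(2)
proof (induction us)
  case Nil
  then show ?case
    using words_closed[OF assms(1,3)] by (simp add: word_prod_def)
next
  case (Cons u us)
  then have us: "us \<in> words G S" and "u \<in> carrier G"
    using assms(1) by (auto simp: words_def)
  then show ?case
    using Cons.IH[OF us] words_closed[OF assms(1) us] words_closed[OF assms(1,3)]
    by (simp add: word_prod_def m_assoc)
qed

lemma words_append: "us \<in> words G S \<Longrightarrow> ws \<in> words G S \<Longrightarrow> us @ ws \<in> words G S"
  by (simp add: words_def)

lemma generate_imp_word:
  assumes "S \<subseteq> carrier G" "x \<in> generate G S"
  shows "\<exists>ws \<in> words G S. word_prod G ws = x"
  using assms(2)
proof induction
  case one
  show ?case by (rule bexI[of _ "[]"]) (auto simp: words_def word_prod_def)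
next
  case (incl h)
  then show ?case
    using assms(1) by (intro bexI[of _ "[h]"]) (auto simp: words_def word_prod_def)
next
  case (inv h)
  then show ?case
    using assms(1) by (intro bexI[of _ "[inv h]"]) (auto simp: words_def word_prod_def)
next
  case (eng h1 h2)
  then show ?case
    using word_prod_append[OF assms(1)] words_append by metis
qed

lemma word_length_le_iff:
  assumes "finite_generating_set G S" "x \<in> carrier G"
  shows "word_length G S x \<le> n \<longleftrightarrow> (\<exists>ws \<in> words G S. length ws \<le> n \<and> word_prod G ws = x)"
    (is "_ \<longleftrightarrow> ?R")
proof
  let ?P = "\<lambda>n. \<exists>ws \<in> words G S. length ws = n \<and> word_prod G ws = x"
  have "\<exists>n. ?P n"
    using generate_imp_word[of S x] assms by (auto simp: finite_generating_set_def)
  then have "?P (word_length G S x)"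
    unfolding word_length_def by (rule LeastI_ex)
  then show "word_length G S x \<le> n \<Longrightarrow> ?R" by (metis (no_types))
  assume ?R
  then obtain ws where ws: "ws \<in> words G S" "length ws \<le> n" "word_prod G ws = x"
    by blast
  then have "word_length G S x \<le> length ws"
    unfolding word_length_def by (intro Least_le) blast
  then show "word_length G S x \<le> n"
    using ws(2) by simp
qed

lemma ball_eq_image:
  assumes "finite_generating_set G S"
  shows "{x \<in> carrier G. word_length G S x \<le> n} = word_prod G ` {ws \<in> words G S. length ws \<le> n}"
proof -
  have "S \<subseteq> carrier G"
    using assms by (simp add: finite_generating_set_def)
  then show ?thesis
    using word_length_le_iff[OF assms] words_closed by (fastforce simp: image_iff)
qed

lemma finite_ball:
  assumes "finite_generating_set G S"
  shows "finite {x \<in> carrier G. word_length G S x \<le> n}"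
proof -
  have "finite {ws. set ws \<subseteq> S \<union> m_inv G ` S \<and> length ws \<le> n}"
    using assms by (intro finite_lists_length_le) (simp add: finite_generating_set_def)
  then show ?thesis
    unfolding ball_eq_image[OF assms] by (simp add: words_def lists_eq_set)
qed

lemma growth_ge_1:
  assumes "finite_generating_set G S"
  shows "growth G S n \<ge> 1"
proof -
  have "\<one> \<in> {x \<in> carrier G. word_length G S x \<le> n}"
    unfolding ball_eq_image[OF assms]
    by (rule image_eqI[of _ _ "[]"]) (auto simp: words_def word_prod_def)
  then show ?thesis
    unfolding growth_def using finite_ball[OF assms, of n]
    by (metis One_nat_def Suc_leI card_gt_0_iff empty_iff)
qed

lemma growth_le:
  assumes S: "finite_generating_set G S" and T: "finite_generating_set G T"
  obtains c where "c \<ge> 1" "\<And>n. growth G S n \<le> growth G T (c * n)"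
proof -
  let ?A = "S \<union> m_inv G ` S"
  have fin: "finite ?A" and SG: "S \<subseteq> carrier G" and TG: "T \<subseteq> carrier G" and AG: "?A \<subseteq> carrier G"
    using S T by (auto simp: finite_generating_set_def)
  define c where "c = Suc (\<Sum>a\<in>?A. word_length G T a)"
  have le: "word_length G T a \<le> c" if "a \<in> ?A" for a
    unfolding c_def using member_le_sum[OF that, of "word_length G T"] fin by simp
  have *: "\<exists>us \<in> words G T. length us \<le> c * length ws \<and> word_prod G us = word_prod G ws"
    if "ws \<in> words G S" for ws
    using that
  proof (induction ws)
    case Nil
    show ?case by (rule bexI[of _ "[]"]) (auto simp: words_def)
  next
    case (Cons a ws)
    then have a: "a \<in> ?A" and ws: "ws \<in> words G S"
      by (auto simp: words_def)
    obtain us where us: "us \<in> words G T" "length us \<le> c * length ws"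
        "word_prod G us = word_prod G ws"
      using Cons.IH[OF ws] by blast
    obtain vs where vs: "vs \<in> words G T" "length vs \<le> c" "word_prod G vs = a"
      using le[OF a] word_length_le_iff[OF T] a AG by blast
    show ?case
    proof (rule bexI[of _ "vs @ us"], intro conjI)
      show "length (vs @ us) \<le> c * length (a # ws)"
        using us vs by simp
      show "word_prod G (vs @ us) = word_prod G (a # ws)"
        using word_prod_append[OF TG vs(1) us(1)] us vs by (simp add: word_prod_def)
      show "vs @ us \<in> words G T"
        using us vs words_append by blast
    qed
  qed
  show ?thesis
  proof (rule that)
    show "c \<ge> 1" by (simp add: c_def)
    fix n
    have "{x \<in> carrier G. word_length G S x \<le> n} \<subseteq> {x \<in> carrier G. word_length G T x \<le> c * n}"
    proof
      fix x assume x: "x \<in> {x \<in> carrier G. word_length G S x \<le> n}"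
      then obtain ws where "ws \<in> words G S" "length ws \<le> n" "word_prod G ws = x"
        using word_length_le_iff[OF S] by blast
      then obtain us where "us \<in> words G T" "length us \<le> c * n" "word_prod G us = x"
        using *[of ws] by (meson mult_le_mono2 order_trans)
      then show "x \<in> {x \<in> carrier G. word_length G T x \<le> c * n}"
        using word_length_le_iff[OF T] x by blast
    qed
    then show "growth G S n \<le> growth G T (c * n)"
      unfolding growth_def by (intro card_mono finite_ball[OF T])
  qed
qed

lemma growth_limit_change:
  assumes S: "finite_generating_set G S" and T: "finite_generating_set G T"
    and lim: "(\<lambda>n. root n (real (growth G T n))) \<longlonglongrightarrow> 1"
  shows "(\<lambda>n. root n (real (growth G S n))) \<longlonglongrightarrow> 1"
proof -
  obtain c where c: "c \<ge> 1" "\<And>n. growth G S n \<le> growth G T (c * n)"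
    using growth_le[OF S T] by blast
  let ?u = "\<lambda>n. root (c * n) (real (growth G T (c * n))) ^ c"
  have "strict_mono (\<lambda>n. c * n)"
    using c(1) by (auto simp: strict_mono_def)
  from LIMSEQ_subseq_LIMSEQ[OF lim this]
  have "(\<lambda>n. root (c * n) (real (growth G T (c * n)))) \<longlonglongrightarrow> 1"
    by (simp add: o_def)
  from tendsto_power[OF this, of c] have up: "?u \<longlonglongrightarrow> 1" by simp
  have ev: "\<forall>\<^sub>F n in sequentially. 1 \<le> root n (real (growth G S n)) \<and> root n (real (growth G S n)) \<le> ?u n"
    using eventually_gt_at_top[of 0]
  proof eventually_elim
    case (elim n)
    have "root n (real (growth G S n)) \<le> root n (real (growth G T (c * n)))"
      using elim c(2) by (simp add: real_root_le_mono)
    also have "\<dots> = ?u n"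
      using c(1) by (subst real_root_mult_exp, subst real_root_pow_pos2) (simp_all add: real_root_ge_zero)
    finally show ?case
      using elim growth_ge_1[OF S, of n] by simp
  qed
  show ?thesis
    by (rule tendsto_sandwich[OF _ _ tendsto_const up]) (use ev in \<open>auto elim: eventually_mono\<close>)
qed

lemma sub_exponential_growth_iff:
  assumes "finite_generating_set G S"
  shows "sub_exponential_growth G \<longleftrightarrow> (\<lambda>n. root n (real (growth G S n))) \<longlonglongrightarrow> 1"
  using assms growth_limit_change unfolding sub_exponential_growth_def by blast

end

end

theory Submission
  imports Defs "HOL-Library.Multiset"
begin

text \<open>Fix \<open>r\<close>, let \<open>B\<close> be the ball of radius \<open>r\<close> in \<open>\<Gamma>\<close> and choose a lift to \<open>B\<close> of every
  element of its image in \<open>G\<close>. An element of the ball of radius \<open>r m\<close> is a product of \<open>m\<close> elements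
  of \<open>B\<close>, each of which is a lift times one of finitely many kernel elements. Moving the
  kernel elements to the right conjugates them, but they stay in a finite conjugation-invariant
  set \<open>F\<close>. As \<open>x y = y (y\<^sup>-\<^sup>1 x y)\<close>, a product of \<open>m\<close> elements of \<open>F\<close> can be sorted (the
  argument of Dietzmann's lemma), so there are at most \<open>(m + 1) ^ card F\<close> such products. Hence
  \<open>v\<^sub>\<Gamma> (r m) \<le> v\<^sub>G r ^ m * (m + 1) ^ card F\<close>, and the exponential growth rate of \<open>\<Gamma>\<close> is
  at most the \<open>r\<close>-th root of \<open>v\<^sub>G r\<close>, for every \<open>r\<close>.\<close>

section \<open>Counting sorted lists\<close>

lemma card_sorted_lists_le:
  "card {xs \<in> lists {..<k::nat}. sorted xs \<and> length xs = m} \<le> (m + 1) ^ k"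
proof -
  let ?A = "{xs \<in> lists {..<k}. sorted xs \<and> length xs = m}"
  \<comment> \<open>A sorted list is determined by its multiplicities, and each of them is at most
    \<open>m\<close>. Restricting to \<open>{..<k}\<close> makes the function extensional, so that
    \<open>card_PiE\<close> counts the possible values.\<close>
  let ?c = "\<lambda>xs. \<lambda>i\<in>{..<k}. count (mset xs) i"
  have "inj_on ?c ?A"
  proof (rule inj_onI)
    fix xs ys assume xs: "xs \<in> ?A" and ys: "ys \<in> ?A" and eq: "?c xs = ?c ys"
    have "count (mset xs) i = count (mset ys) i" for i
    proof (cases "i < k")
      case True
      then show ?thesis using fun_cong[OF eq, of i] by simp
    next
      case False
      then have "i \<notin> set xs" "i \<notin> set ys" using xs ys by auto
      then show ?thesis by (metis count_mset_0_iff)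
    qed
    then have "mset xs = mset ys" by (rule multiset_eqI)
    moreover have "sorted xs" "sorted ys" using xs ys by blast+
    ultimately show "xs = ys" by (metis properties_for_sort)
  qed
  moreover have "?c ` ?A \<subseteq> {..<k} \<rightarrow>\<^sub>E {..m}"
    by (auto simp: PiE_iff split: if_splits) (metis count_le_size size_mset)
  ultimately have "card ?A \<le> card ({..<k} \<rightarrow>\<^sub>E {..m})"
    by (intro card_inj_on_le) (auto intro: finite_PiE)
  then show ?thesis by (simp add: card_PiE)
qed

lemma not_sorted_adjacent:
  fixes xs :: "'a::linorder list"
  assumes "\<not> sorted xs"
  obtains us a b vs where "xs = us @ a # b # vs" "b < a"
proof -
  obtain i where i: "Suc i < length xs" "xs ! Suc i < xs ! i"
    using assms by (auto simp: sorted_iff_nth_Suc not_le)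
  then have "xs = take i xs @ xs ! i # xs ! Suc i # drop (Suc (Suc i)) xs"
    by (simp add: Cons_nth_drop_Suc)
  then show thesis using that i(2) by blast
qed

section \<open>A criterion for the roots to tend to 1\<close>

lemma tendsto_root_one_if_exponential_bounds:
  fixes v :: "nat \<Rightarrow> real"
  assumes ge1: "\<And>n. v n \<ge> 1"
    and bound: "\<And>e. e > 0 \<Longrightarrow> \<exists>p C k. 1 \<le> p \<and> p < 1 + e \<and> 0 < C \<and>
      (\<forall>n>0. v n \<le> p ^ n * C * real n ^ k)"
  shows "(\<lambda>n. root n (v n)) \<longlonglongrightarrow> 1"
proof (rule order_tendstoI)
  fix a :: real assume "a < 1"
  show "\<forall>\<^sub>F n in sequentially. a < root n (v n)"
    \<comment> \<open>\<open>root 0\<close> is constantly \<open>0\<close>, so the lower bound holds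
      only from \<open>n = 1\<close> on.\<close>
    using eventually_gt_at_top[of 0]
  proof eventually_elim
    case (elim n)
    then have "1 \<le> root n (v n)" using ge1[of n] by simp
    then show ?case using \<open>a < 1\<close> by simp
  qed
next
  fix a :: real assume "1 < a"
  then obtain p C and k :: nat where p: "1 \<le> p" "p < a" "0 < C"
    and v: "\<And>n. n > 0 \<Longrightarrow> v n \<le> p ^ n * C * real n ^ k"
    using bound[of "a - 1"] by auto
  \<comment> \<open>The \<open>n\<close>-th roots of the constant and of the polynomial factor tend
    to 1, so only \<open>p\<close> survives in the limit.\<close>
  have "(\<lambda>n. p * root n C * root n (real n) ^ k) \<longlonglongrightarrow> p * 1 * 1 ^ k"
    by (intro tendsto_intros LIMSEQ_root LIMSEQ_root_const p)
  then have "\<forall>\<^sub>F n in sequentially. p * root n C * root n (real n) ^ k < a"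
    using p(2) by (intro order_tendstoD(2)) auto
  then show "\<forall>\<^sub>F n in sequentially. root n (v n) < a"
    using eventually_gt_at_top[of 0]
  proof eventually_elim
    case (elim n)
    have "root n (v n) \<le> root n (p ^ n * C * real n ^ k)"
      using elim v by (simp add: real_root_le_mono)
    also have "\<dots> = p * root n C * root n (real n) ^ k"
      using elim p by (simp add: real_root_mult real_root_power real_root_power_cancel)
    finally show ?case using elim by simp
  qed
qed

section \<open>Sorting products in a conjugation-invariant set; splitting balls\<close>

context group
begin

text \<open>With the whole carrier as alphabet, the facts on words apply to arbitrary lists of group
  elements.\<close>

lemma words_carrier: "words G (carrier G) = lists (carrier G)"
  by (auto simp: words_def lists_eq_set)

lemmas word_prod_closed_carrier = words_closed[OF subset_refl, unfolded words_carrier]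

lemmas word_prod_append_carrier = word_prod_append[OF subset_refl, unfolded words_carrier]

lemma word_prod_Cons: "word_prod G (x # xs) = x \<otimes> word_prod G xs"
  by (simp add: word_prod_def)

text \<open>An adjacent descent is removed by \<open>x y = y (y^-1 x y)\<close>; by
  \<open>conj\<close> the new factor is again some \<open>e c\<close>, so the length is kept. The
  index \<open>c\<close> may exceed \<open>a\<close>, so the number of inversions need not drop. The
  first changed entry does drop, from \<open>a\<close> to \<open>b\<close>, and the induction is
  therefore on the lexicographic order.\<close>

lemma word_prod_sorted:
  fixes e :: "nat \<Rightarrow> 'a"
  assumes e: "\<And>i. i < k \<Longrightarrow> e i \<in> carrier G"
    and conj: "\<And>i j. i < k \<Longrightarrow> j < k \<Longrightarrow> inv (e j) \<otimes> e i \<otimes> e j \<in> e ` {..<k}"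
    and xs: "xs \<in> lists {..<k}"
  shows "\<exists>ys \<in> lists {..<k}. sorted ys \<and> length ys = length xs \<and>
    word_prod G (map e ys) = word_prod G (map e xs)"
  using xs
proof (induction xs rule: wf_induct_rule[OF wf_lex[OF wf_less_than]])
  case (1 xs)
  show ?case
  proof (cases "sorted xs")
    case True
    then show ?thesis using 1 by blast
  next
    case False
    then obtain us a b vs where xs: "xs = us @ a # b # vs" and "b < a"
      by (rule not_sorted_adjacent)
    with 1 have ab: "a < k" "b < k" and us: "us \<in> lists {..<k}" and vs: "vs \<in> lists {..<k}"
      by auto
    obtain c where c: "c < k" "e c = inv (e b) \<otimes> e a \<otimes> e b"
      using conj[OF ab] by (metis imageE lessThan_iff)
    let ?zs = "us @ b # c # vs"
    have "(?zs, xs) \<in> lex less_than"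
      unfolding lex_conv xs using \<open>b < a\<close> by auto
    moreover have "?zs \<in> lists {..<k}" using us vs ab c by auto
    ultimately obtain ys where ys: "ys \<in> lists {..<k}" "sorted ys" "length ys = length ?zs"
        "word_prod G (map e ys) = word_prod G (map e ?zs)"
      using "1.IH" by blast
    have car: "map e us \<in> lists (carrier G)" "map e vs \<in> lists (carrier G)"
      "e a \<in> carrier G" "e b \<in> carrier G" "e c \<in> carrier G"
      using us vs ab c(1) e by auto
    have "e b \<otimes> e c = e a \<otimes> e b"
      using car by (simp add: c(2) flip: m_assoc)
    then have "e b \<otimes> (e c \<otimes> word_prod G (map e vs)) = e a \<otimes> (e b \<otimes> word_prod G (map e vs))"
      using car word_prod_closed_carrier[OF car(2)] by (simp flip: m_assoc)
    then have "word_prod G (map e ?zs) = word_prod G (map e xs)"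
      using car by (simp add: xs word_prod_append_carrier word_prod_Cons)
    then show ?thesis using ys xs by auto
  qed
qed

text \<open>Enumerating \<open>F\<close> by the indices below \<open>card F\<close> lets every
  product be rewritten along a sorted list of indices, and those lists are counted above.\<close>

lemma card_word_prods_le:
  assumes F: "finite F" "F \<subseteq> carrier G"
    and conj: "\<And>x y. x \<in> F \<Longrightarrow> y \<in> F \<Longrightarrow> inv y \<otimes> x \<otimes> y \<in> F"
  shows "card (word_prod G ` {xs \<in> lists F. length xs = m}) \<le> (m + 1) ^ card F"
proof -
  let ?k = "card F"
  obtain e where "bij_betw e {0..<?k} F"
    using ex_bij_betw_nat_finite[OF F(1)] by blast
  then have e: "e ` {..<?k} = F"
    by (auto simp: bij_betw_def atLeast0LessThan)
  let ?A = "{xs \<in> lists {..<?k}. sorted xs \<and> length xs = m}"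
  have "word_prod G ` {xs \<in> lists F. length xs = m} \<subseteq> (\<lambda>xs. word_prod G (map e xs)) ` ?A"
  proof (rule image_subsetI)
    fix xs assume "xs \<in> {xs \<in> lists F. length xs = m}"
    then have "xs \<in> lists (e ` {..<?k})" "length xs = m" by (simp_all add: e)
    then obtain us where us: "us \<in> lists {..<?k}" "xs = map e us"
      unfolding lists_image by blast
    then have "length us = m" using \<open>length xs = m\<close> by simp
    moreover obtain ys where "ys \<in> lists {..<?k}" "sorted ys" "length ys = length us"
        "word_prod G (map e ys) = word_prod G (map e us)"
      using word_prod_sorted[OF _ _ us(1), of e] conj e F(2) by blast
    ultimately show "word_prod G xs \<in> (\<lambda>xs. word_prod G (map e xs)) ` ?A"
      using us(2) \<open>length us = m\<close> by (intro image_eqI[of _ _ ys]) auto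
  qed
  moreover have fin: "finite ?A"
    by (rule finite_subset[OF _ finite_lists_length_eq[of "{..<?k}" m]]) (auto simp: lists_eq_set)
  ultimately have "card (word_prod G ` {xs \<in> lists F. length xs = m}) \<le> card ?A"
    using surj_card_le by blast
  also have "\<dots> \<le> (m + 1) ^ ?k" by (rule card_sorted_lists_le)
  finally show ?thesis .
qed

text \<open>Take the union of the conjugacy classes of the elements of \<open>A\<close>. Invariance
  under the whole carrier is what allows moving elements of \<open>F\<close> past arbitrary lifts
  later.\<close>

lemma conj_finite_union_FC:
  assumes "finite A" "A \<subseteq> FC_center G"
  obtains F where "finite F" "F \<subseteq> carrier G" "A \<subseteq> F"
    "\<And>x y. x \<in> F \<Longrightarrow> y \<in> carrier G \<Longrightarrow> inv y \<otimes> x \<otimes> y \<in> F"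
proof
  let ?F = "\<Union>a\<in>A. {g \<otimes> a \<otimes> inv g | g. g \<in> carrier G}"
  have A: "a \<in> carrier G" if "a \<in> A" for a
    using assms(2) that by (auto simp: FC_center_def)
  show "finite ?F" using assms by (auto simp: FC_center_def)
  show "?F \<subseteq> carrier G" using A by auto
  show "A \<subseteq> ?F"
  proof
    fix a assume "a \<in> A"
    then show "a \<in> ?F" using A[of a] by (auto intro!: bexI[of _ a] exI[of _ \<one>])
  qed
  fix x y assume "x \<in> ?F" and y: "y \<in> carrier G"
  then obtain a g where x: "a \<in> A" "g \<in> carrier G" "x = g \<otimes> a \<otimes> inv g" by blast
  have "inv y \<otimes> x \<otimes> y = (inv y \<otimes> g) \<otimes> a \<otimes> inv (inv y \<otimes> g)"
    using x y A by (simp add: m_assoc inv_mult_group)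
  then show "inv y \<otimes> x \<otimes> y \<in> ?F" using x y by blast
qed

text \<open>Cut a word for \<open>x\<close> after its first \<open>a\<close> letters; if it is
  shorter, the second piece is empty.\<close>

lemma ball_add:
  assumes S: "finite_generating_set G S" and x: "x \<in> carrier G" "word_length G S x \<le> a + b"
  obtains y z where "y \<in> carrier G" "word_length G S y \<le> a" "z \<in> carrier G"
    "word_length G S z \<le> b" "x = y \<otimes> z"
proof -
  have SG: "S \<subseteq> carrier G" using S by (simp add: finite_generating_set_def)
  obtain ws where ws: "ws \<in> words G S" "length ws \<le> a + b" "word_prod G ws = x"
    using word_length_le_iff[OF S x(1)] x(2) by blast
  have w: "take a ws \<in> words G S" "drop a ws \<in> words G S"
    using ws(1) set_take_subset[of a ws] set_drop_subset[of a ws]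
    by (auto simp: words_def lists_eq_set)
  show thesis
  proof
    show "word_prod G (take a ws) \<in> carrier G" "word_prod G (drop a ws) \<in> carrier G"
      using words_closed[OF SG] w by blast+
    then show "word_length G S (word_prod G (take a ws)) \<le> a"
      "word_length G S (word_prod G (drop a ws)) \<le> b"
      using word_length_le_iff[OF S] w ws(2) by fastforce+
    show "x = word_prod G (take a ws) \<otimes> word_prod G (drop a ws)"
      using word_prod_append[OF SG w] ws(3) by simp
  qed
qed

end

section \<open>Growth along a surjection with FC-central kernel\<close>

context group_hom
begin

lemma word_prod_map:
  assumes "ws \<in> lists (carrier G)"
  shows "h (word_prod G ws) = word_prod H (map h ws)"
  using assms
proof (induction ws)
  case Nil
  then show ?case by (simp add: word_prod_def)
next
  case (Cons w ws)
  then have "w \<in> carrier G" "word_prod G ws \<in> carrier G"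
    using G.word_prod_closed_carrier by auto
  then show ?case using Cons by (simp add: G.word_prod_Cons H.word_prod_Cons)
qed

lemma finite_generating_set_image:
  assumes "finite_generating_set G S" "h ` carrier G = carrier H"
  shows "finite_generating_set H (h ` S)"
  using assms generate_img[of S] by (simp add: finite_generating_set_def) blast

lemma image_ball_subset:
  assumes S: "finite_generating_set G S" and surj: "h ` carrier G = carrier H"
  shows "h ` {x \<in> carrier G. word_length G S x \<le> n} \<subseteq>
    {y \<in> carrier H. word_length H (h ` S) y \<le> n}"
  unfolding G.ball_eq_image[OF S] H.ball_eq_image[OF finite_generating_set_image[OF S surj]]
proof (rule image_subsetI)
  have SG: "S \<subseteq> carrier G" using S by (simp add: finite_generating_set_def)
  fix y assume "y \<in> word_prod G ` {ws \<in> words G S. length ws \<le> n}"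
  then obtain ws where ws: "ws \<in> words G S" "length ws \<le> n" "y = word_prod G ws" by blast
  have "map h ws \<in> words H (h ` S)"
    using ws(1) SG by (fastforce simp: words_def lists_eq_set)
  moreover have "ws \<in> lists (carrier G)" using ws(1) SG by (auto simp: words_def)
  ultimately show "h y \<in> word_prod H ` {ws \<in> words H (h ` S). length ws \<le> n}"
    using ws word_prod_map by (intro image_eqI[of _ _ "map h ws"]) auto
qed

text \<open>The exponent is \<open>card F\<close>, which depends on \<open>r\<close> but not on
  \<open>m\<close>; for fixed \<open>r\<close> the kernel contributes only a polynomial
  factor.\<close>

lemma growth_FC_extension_le:
  assumes S: "finite_generating_set G S" and surj: "h ` carrier G = carrier H"
    and ker: "kernel G H h \<subseteq> FC_center G"
  obtains k where "\<And>m. growth G S (r * m) \<le> growth H (h ` S) r ^ m * (m + 1) ^ k"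
proof -
  define B where "B n = {x \<in> carrier G. word_length G S x \<le> n}" for n
  define s where "s = inv_into (B r) h"
  let ?D = "h ` B r"
  have Bfin: "finite (B n)" for n unfolding B_def by (rule G.finite_ball[OF S])
  have s: "s y \<in> carrier G" "h (s y) = y" if "y \<in> ?D" for y
    using inv_into_into[OF that] f_inv_into_f[OF that] by (auto simp: s_def B_def)
  \<comment> \<open>These are the corrections between elements of the ball and the chosen lifts;
    they lie in the kernel because \<open>x\<close> and \<open>s (h x)\<close> have the same
    image.\<close>
  define A where "A = (\<lambda>x. inv (s (h x)) \<otimes> x) ` B r"
  have "A \<subseteq> kernel G H h"
    using s by (auto simp: A_def kernel_def B_def)
  then have A: "finite A" "A \<subseteq> FC_center G"
    using ker Bfin by (auto simp: A_def)
  then obtain F where F: "finite F" "F \<subseteq> carrier G" "A \<subseteq> F"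
    "\<And>x y. x \<in> F \<Longrightarrow> y \<in> carrier G \<Longrightarrow> inv y \<otimes> x \<otimes> y \<in> F"
    using G.conj_finite_union_FC[OF A] by blast
  define W where "W m = word_prod G ` {xs \<in> lists F. length xs = m}" for m
  define L where "L m = {gs \<in> lists ?D. length gs = m}" for m
  have L: "finite (L m)" "card (L m) = card ?D ^ m" for m
    using Bfin finite_lists_length_eq[of ?D m] card_lists_length_eq[of ?D m]
    by (simp_all add: L_def lists_eq_set)
  have Wfin: "finite (W m)" for m
    using F(1) finite_lists_length_eq[of F m] by (simp add: W_def lists_eq_set)
  have lift: "\<exists>gs \<in> L m. \<exists>w \<in> W m. x = word_prod G (map s gs) \<otimes> w" if "x \<in> B (r * m)" for x m
    using that
  proof (induction m arbitrary: x)
    case 0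
    then have "x = \<one>"
      using G.ball_eq_image[OF S, of 0] by (auto simp: B_def word_prod_def)
    then show ?case
      by (intro bexI[of _ "[]"] bexI[of _ \<one>]) (auto simp: L_def W_def word_prod_def image_iff)
  next
    case (Suc m)
    have "x \<in> carrier G" "word_length G S x \<le> r + r * m"
      using Suc.prems by (simp_all add: B_def)
    from G.ball_add[OF S this] obtain y z
      where "y \<in> carrier G" "word_length G S y \<le> r"
        "z \<in> carrier G" "word_length G S z \<le> r * m" and x: "x = y \<otimes> z" .
    then have y: "y \<in> B r" and z: "z \<in> B (r * m)" by (simp_all add: B_def)
    obtain gs w where gs: "gs \<in> L m" and w: "w \<in> W m"
      and zw: "z = word_prod G (map s gs) \<otimes> w"
      using Suc.IH[OF z] by blast
    obtain xs where xs: "xs \<in> lists F" "length xs = m" "w = word_prod G xs"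
      using w by (auto simp: W_def)
    define p where "p = word_prod G (map s gs)"
    have "map s gs \<in> lists (carrier G)" using gs s(1) by (auto simp: L_def)
    then have p: "p \<in> carrier G"
      unfolding p_def by (rule G.word_prod_closed_carrier)
    have wG: "w \<in> carrier G" using xs F(2) G.word_prod_closed_carrier[of xs] by auto
    define a where "a = inv (s (h y)) \<otimes> y"
    have sy: "s (h y) \<in> carrier G" and yG: "y \<in> carrier G" using s y by (auto simp: B_def)
    have "a \<in> F" using y F(3) by (auto simp: A_def a_def)
    then have aG: "a \<in> carrier G" and a': "inv p \<otimes> a \<otimes> p \<in> F" using F p by auto
    have "y = s (h y) \<otimes> a" unfolding a_def using sy yG by (simp flip: G.m_assoc)
    \<comment> \<open>The correction of the first block moves right past the lifts \<open>p\<close>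
      of the later blocks, and its conjugate joins the product \<open>w\<close> of elements of
      \<open>F\<close>.\<close>
    moreover have "a \<otimes> p = p \<otimes> (inv p \<otimes> a \<otimes> p)"
      using aG p by (simp flip: G.m_assoc)
    ultimately have "x = (s (h y) \<otimes> p) \<otimes> ((inv p \<otimes> a \<otimes> p) \<otimes> w)"
      unfolding x zw p_def[symmetric] using sy aG p wG
      by (metis G.inv_closed G.m_assoc G.m_closed)
    moreover have "s (h y) \<otimes> p = word_prod G (map s (h y # gs))"
      by (simp add: G.word_prod_Cons p_def)
    moreover have "(inv p \<otimes> a \<otimes> p) \<otimes> w \<in> W (Suc m)"
      unfolding W_def using xs a'
      by (intro image_eqI[of _ _ "(inv p \<otimes> a \<otimes> p) # xs"]) (auto simp: G.word_prod_Cons)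
    moreover have "h y # gs \<in> L (Suc m)" using gs y by (auto simp: L_def)
    ultimately show ?case by metis
  qed
  have D: "card ?D \<le> growth H (h ` S) r"
    unfolding growth_def B_def
    by (intro card_mono H.finite_ball finite_generating_set_image image_ball_subset S surj)
  have "growth G S (r * m) \<le> growth H (h ` S) r ^ m * (m + 1) ^ card F" for m
  proof -
    have "B (r * m) \<subseteq> (\<lambda>(gs, w). word_prod G (map s gs) \<otimes> w) ` (L m \<times> W m)"
      using lift by fastforce
    then have "card (B (r * m)) \<le> card (L m \<times> W m)"
      using L(1) Wfin by (intro surj_card_le) auto
    also have "\<dots> \<le> growth H (h ` S) r ^ m * (m + 1) ^ card F"
      unfolding card_cartesian_product L(2) W_def using F
      by (intro mult_le_mono power_mono D G.card_word_prods_le) auto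
    finally show ?thesis by (simp add: growth_def B_def)
  qed
  then show thesis by (rule that)
qed

end

theorem lemma1p1:
  fixes \<Gamma> :: "('a, 'c) monoid_scheme" and G :: "('b, 'd) monoid_scheme"
  assumes "group \<Gamma>" and "group G"
    and "finitely_generated \<Gamma>"
    and "FC_central_extension \<Gamma> G"
    and "sub_exponential_growth G"
  shows "sub_exponential_growth \<Gamma>"
proof -
  obtain f where f: "f \<in> hom \<Gamma> G" "f ` carrier \<Gamma> = carrier G"
    and ker: "kernel \<Gamma> G f \<subseteq> FC_center \<Gamma>"
    using assms(4) by (auto simp: FC_central_extension_def epi_def)
  interpret group_hom \<Gamma> G f
    using assms(1,2) f(1) by (simp add: group_hom_def group_hom_axioms_def)
  obtain S where S: "finite_generating_set \<Gamma> S"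
    using assms(3) by (auto simp: finitely_generated_def)
  note T = finite_generating_set_image[OF S f(2)]
  let ?v = "growth G (f ` S)"
  have lim: "(\<lambda>n. root n (real (?v n))) \<longlonglongrightarrow> 1"
    using assms(5) H.sub_exponential_growth_iff[OF T] by blast
  have "(\<lambda>n. root n (real (growth \<Gamma> S n))) \<longlonglongrightarrow> 1"
  proof (rule tendsto_root_one_if_exponential_bounds)
    show "1 \<le> real (growth \<Gamma> S n)" for n using G.growth_ge_1[OF S, of n] by simp
    fix e :: real assume "e > 0"
    then have "\<forall>\<^sub>F r in sequentially. root r (real (?v r)) < 1 + e \<and> 0 < r"
      using order_tendstoD(2)[OF lim] eventually_gt_at_top by (intro eventually_conj) auto
    \<comment> \<open>One radius \<open>r\<close> is fixed for the given \<open>e\<close>; it serves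
      all \<open>n\<close>.\<close>
    then obtain r where r: "root r (real (?v r)) < 1 + e" "0 < r"
      using eventually_happens by force
    define p where "p = root r (real (?v r))"
    have p1: "1 \<le> p" using H.growth_ge_1[OF T, of r] r(2) by (simp add: p_def)
    have pr: "p ^ r = real (?v r)" unfolding p_def using r(2) by simp
    obtain k where k: "\<And>m. growth \<Gamma> S (r * m) \<le> ?v r ^ m * (m + 1) ^ k"
      using growth_FC_extension_le[OF S f(2) ker] by blast
    have "real (growth \<Gamma> S n) \<le> p ^ n * (p ^ r * 3 ^ k) * real n ^ k" if "n > 0" for n
    proof -
      \<comment> \<open>Rounding up gives \<open>n \<le> r * m\<close>. The overshoot of at most
        \<open>r\<close> costs the factor \<open>p ^ r\<close>, and
        \<open>m + 1 \<le> n + 2 \<le> 3 * n\<close> costs \<open>3 ^ k\<close>.\<close>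
      define m where "m = n div r + 1"
      have m: "n \<le> r * m" "r * m \<le> n + r" "m + 1 \<le> 3 * n"
        using that div_le_dividend[of n r] mult_div_mod_eq[of r n] mod_less_divisor[OF r(2), of n]
        unfolding m_def distrib_left by linarith+
      have "growth \<Gamma> S n \<le> growth \<Gamma> S (r * m)"
        unfolding growth_def using m(1) by (intro card_mono G.finite_ball[OF S]) auto
      then have "real (growth \<Gamma> S n) \<le> real (?v r ^ m * (m + 1) ^ k)"
        using k[of m] by linarith
      also have "\<dots> = p ^ (r * m) * real (m + 1) ^ k"
        by (simp add: pr power_mult)
      also have "\<dots> \<le> p ^ (n + r) * real (3 * n) ^ k"
        using m p1 by (intro mult_mono power_increasing power_mono of_nat_mono) auto
      also have "\<dots> = p ^ n * (p ^ r * 3 ^ k) * real n ^ k"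
        by (simp add: power_add power_mult_distrib)
      finally show ?thesis .
    qed
    then show "\<exists>p C k. 1 \<le> p \<and> p < 1 + e \<and> 0 < C \<and>
        (\<forall>n>0. real (growth \<Gamma> S n) \<le> p ^ n * C * real n ^ k)"
      using p1 r(1) by (intro exI[of _ p] exI[of _ "p ^ r * 3 ^ k"] exI[of _ k]) (auto simp: p_def[symmetric])
  qed
  then show ?thesis using S unfolding sub_exponential_growth_def by blast
qed

end
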